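(* Let $\Omega\subset\mathbb R^n$ be an unbounded domain. Let $a^{ij},b^i,c\in C^0(\overline\Omega,\mathbb R)$ ($i,j=1,\dots,n$) be such that the matrix $(a^{ij}(x))$ is symmetric and positive definite for every $x\in\overline\Omega$. Assume there are constants $H<\infty$ and $\Lambda<\infty$ with $$\|a^{ij}\|_{C^0(\Omega)}+\|b^i\|_{C^0(\Omega)}+\|c\|_{C^0(\Omega)}\le H\quad (i,j=1,\dots,n),\qquad c(x)\le 0\ \text{ in }\Omega,$$ $$\frac1\Lambda|\xi|^2\le a^{ij}(x)\xi_i\xi_j\le\Lambda|\xi|^2\quad\text{for all }x\in\Omega,\ \xi\in\mathbb R^n.$$ Assume moreover: a) $\Omega$ has bounded thickness, i.e. $\sup_{x\in\Omega}\operatorname{dist}(x,\partial\Omega)<+\infty$. b) $u\in C^2(\Omega,\mathbb R)\cap C^0(\overline\Omega,\mathbb R)$ is a bounded solution of $$a^{ij}(x)\partial_{ij}u+b^i(x)\partial_iu+c(x)u=0\ \text{ in }\Omega,\qquad u=0\ \text{ on }\partial\Omega.$$ c) For any sequence $x_k\in\Omega$ with $\operatorname{dist}(x_k,\partial\Omega)\to0$ as $k\to\infty$, it follows that $u(x_k)\to0$ as $k\to\infty$. Then $u\equiv0$ in $\Omega$.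
   Context: A domain is a nonempty connected open set. The summation convention is used: repeated indices $i,j$ are summed from $1$ to $n$. $\partial_i,\partial_{ij}$ denote first and second partial derivatives. $\|\cdot\|_{C^0(\Omega)}$ is the supremum norm on $\Omega$. $\operatorname{dist}(x,\partial\Omega)=\inf_{y\in\partial\Omega}|x-y|$, with the usual convention that the infimum over the empty set is $+\infty$. *)

theory Defs
  imports "HOL-Analysis.Analysis"
begin

definition domain :: "(real ^ 'n) set \<Rightarrow> bool" where
  "domain \<Omega> \<longleftrightarrow> \<Omega> \<noteq> {} \<and> open \<Omega> \<and> connected \<Omega>"

definition partial_deriv :: "'n \<Rightarrow> (real ^ 'n \<Rightarrow> real) \<Rightarrow> real ^ 'n \<Rightarrow> real" where
  "partial_deriv i f x = deriv (\<lambda>t. f (x + t *\<^sub>R axis i 1)) 0"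

definition has_partial_deriv_at :: "'n \<Rightarrow> (real ^ 'n \<Rightarrow> real) \<Rightarrow> real ^ 'n \<Rightarrow> bool" where
  "has_partial_deriv_at i f x \<longleftrightarrow> (\<lambda>t. f (x + t *\<^sub>R axis i 1)) field_differentiable (at 0)"

(* Intended for open S: then the partial derivatives at points of S depend only on
   the values of f on S. *)
primrec Ck_on :: "nat \<Rightarrow> (real ^ 'n) set \<Rightarrow> (real ^ 'n \<Rightarrow> real) \<Rightarrow> bool" where
  "Ck_on 0 S f \<longleftrightarrow> continuous_on S f"
| "Ck_on (Suc k) S f \<longleftrightarrow> continuous_on S f \<and>
     (\<forall>i. (\<forall>x\<in>S. has_partial_deriv_at i f x) \<and> Ck_on k S (partial_deriv i f))"

(* Taken in the extended reals, so that it is infinite for unbounded f. *)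
definition C0_norm :: "(real ^ 'n) set \<Rightarrow> (real ^ 'n \<Rightarrow> real) \<Rightarrow> ereal" where
  "C0_norm S f = (SUP x\<in>S. ereal \<bar>f x\<bar>)"

(* Unlike infdist, which is 0 for the empty set, this is infinite if the boundary is empty. *)
definition boundary_dist :: "(real ^ 'n) set \<Rightarrow> real ^ 'n \<Rightarrow> ereal" where
  "boundary_dist \<Omega> x = (INF y\<in>frontier \<Omega>. ereal (dist x y))"

definition pos_def_matrix :: "real ^ 'n ^ 'n \<Rightarrow> bool" where
  "pos_def_matrix A \<longleftrightarrow> (\<forall>\<xi>. \<xi> \<noteq> 0 \<longrightarrow> 0 < \<xi> \<bullet> (A *v \<xi>))"

end

(* Let M = sup u > 0 and let q be any point of Omega. Pick y on the boundary with |q - y| < D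
   and maximise u + (M/2) exp(-alpha |x - y|^2) over the points of closure Omega within distance
   R = D + 1 of y. Condition c) gives u <= M/2 within distance delta of y. For alpha large,
   depending only on n, H, Lambda, D and delta, the second-order conditions rule out a maximum
   at an interior point with u >= 0 and delta <= |x - y| < R. So the maximum is at most
   M + (M/2) exp(-alpha R^2), whence u(q) <= M - eta with eta > 0 independent of q, contradicting
   the choice of M. Centring the barrier at a boundary point makes Harnack chains unnecessary.
   The same applies to -u. *)
theory Submission
  imports Defs
begin

section \<open>Linear algebra: the trace of a product of two positive matrices\<close>

text \<open>Symmetric elimination, one pivot at a time: \<open>A\<close> is its Schur complement
  plus a rank-one matrix built from row k. The first contributes a sum covered by the induction
  hypothesis, the second the quadratic form of \<open>B\<close> at that row, divided by the positive
  pivot. \<open>B\<close> enters only through its quadratic form, so a matrix of iterated partial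
  derivatives can be inserted without first proving that they commute.\<close>

lemma sum_posdef_times_psd_nonneg:
  fixes A B :: "'a \<Rightarrow> 'a \<Rightarrow> real"
  assumes "finite I"
    and "\<And>i j. A i j = A j i"
    and "\<And>v. \<exists>i\<in>I. v i \<noteq> 0 \<Longrightarrow> 0 < (\<Sum>i\<in>I. \<Sum>j\<in>I. A i j * v i * v j)"
    and "\<And>v. 0 \<le> (\<Sum>i\<in>I. \<Sum>j\<in>I. B i j * v i * v j)"
  shows "0 \<le> (\<Sum>i\<in>I. \<Sum>j\<in>I. A i j * B i j)"
  using assms
proof (induction I arbitrary: A rule: finite_induct)
  case empty
  then show ?case by simp
next
  case (insert k I)
  note sym = insert.prems(1)
  have split: "(\<Sum>i\<in>insert k I. \<Sum>j\<in>insert k I. f i j) =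
      f k k + (\<Sum>j\<in>I. f k j) + (\<Sum>i\<in>I. f i k) + (\<Sum>i\<in>I. \<Sum>j\<in>I. f i j)"
    for f :: "'a \<Rightarrow> 'a \<Rightarrow> real"
    using insert.hyps by (simp add: sum.distrib)
  have Akk: "0 < A k k"
  proof -
    have z: "(\<lambda>i. if i = k then 1 else 0 :: real) j = 0" if "j \<in> I" for j
      using that insert.hyps by auto
    have "0 < (\<Sum>i\<in>insert k I. \<Sum>j\<in>insert k I.
        A i j * (if i = k then 1 else 0) * (if j = k then 1 else 0))"
      by (rule insert.prems(2)[of "\<lambda>i. if i = k then 1 else 0"]) simp
    then show ?thesis
      unfolding split using insert.hyps
      by (simp add: z sum.neutral)
  qed
  \<comment> \<open>Schur complement of the pivot: positive definite, and it differs from A by a rank-one matrix.\<close>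
  define A' where "A' i j = A i j - A k i * A k j / A k k" for i j
  have A'sym: "A' i j = A' j i" for i j
    unfolding A'_def by (simp add: sym[of i j])
  have A'pos: "0 < (\<Sum>i\<in>I. \<Sum>j\<in>I. A' i j * v i * v j)" if v: "\<exists>i\<in>I. v i \<noteq> 0" for v
  proof -
    define s where "s = (\<Sum>i\<in>I. A k i * v i)"
    \<comment> \<open>The new coordinate minimises the form of \<open>A\<close> over all extensions
      of v to index k. At this minimiser the form of \<open>A\<close> equals the form of
      \<open>A'\<close> at v.\<close>
    define w where "w = v(k := - s / A k k)"
    have w: "w i = v i" if "i \<in> I" for i
      using that insert.hyps by (auto simp: w_def)
    have wk: "w k = - s / A k k" by (simp add: w_def)
    have "0 < (\<Sum>i\<in>insert k I. \<Sum>j\<in>insert k I. A i j * w i * w j)"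
      using v w by (intro insert.prems(2)) force
    also have "\<dots> = A k k * w k * w k + (\<Sum>j\<in>I. A k j * w k * v j)
        + (\<Sum>i\<in>I. A i k * v i * w k) + (\<Sum>i\<in>I. \<Sum>j\<in>I. A i j * v i * v j)"
      unfolding split by (simp add: w cong: sum.cong)
    also have "(\<Sum>j\<in>I. A k j * w k * v j) = w k * s"
      unfolding s_def sum_distrib_left by (simp add: mult_ac)
    also have "(\<Sum>i\<in>I. A i k * v i * w k) = w k * s"
      unfolding s_def sum_distrib_left by (simp add: mult_ac sym[of _ k])
    also have "A k k * w k * w k + w k * s + w k * s = - (s * s / A k k)"
      unfolding wk using Akk by (simp add: field_simps)
    also have "s * s / A k k = (\<Sum>i\<in>I. \<Sum>j\<in>I. A k i * A k j / A k k * v i * v j)"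
      unfolding s_def sum_product sum_divide_distrib by (simp add: mult_ac)
    finally show ?thesis
      by (simp add: A'_def left_diff_distrib sum_subtractf)
  qed
  have Bpos: "0 \<le> (\<Sum>i\<in>I. \<Sum>j\<in>I. B i j * v i * v j)" for v
  proof -
    have w: "(v(k := 0)) i = v i" if "i \<in> I" for i
      using that insert.hyps by auto
    show ?thesis
    proof -
      have "(\<Sum>i\<in>I. \<Sum>j\<in>I. B i j * (v(k := 0)) i * (v(k := 0)) j) =
          (\<Sum>i\<in>I. \<Sum>j\<in>I. B i j * v i * v j)"
        by (intro sum.cong refl) (simp only: w)
      then show ?thesis
        using insert.prems(3)[of "v(k := 0)"] unfolding split by simp
    qed
  qed
  have "0 \<le> (\<Sum>i\<in>I. \<Sum>j\<in>I. A' i j * B i j)"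
    using insert.IH[of A'] A'sym A'pos Bpos by blast
  moreover have "0 \<le> (\<Sum>i\<in>insert k I. \<Sum>j\<in>insert k I. B i j * A k i * A k j) / A k k"
    using insert.prems(3)[of "A k"] Akk by simp
  \<comment> \<open>The rank-one matrix agrees with \<open>A\<close> on all of row and column k, so
    \<open>A'\<close> contributes over \<open>I\<close> only.\<close>
  moreover have "(\<Sum>i\<in>insert k I. \<Sum>j\<in>insert k I. A i j * B i j) =
     (\<Sum>i\<in>I. \<Sum>j\<in>I. A' i j * B i j) + (\<Sum>i\<in>insert k I. \<Sum>j\<in>insert k I. B i j * A k i * A k j) / A k k"
  proof -
    have "(\<Sum>i\<in>I. \<Sum>j\<in>I. A' i j * B i j) =
       (\<Sum>i\<in>I. \<Sum>j\<in>I. A i j * B i j) - (\<Sum>i\<in>I. \<Sum>j\<in>I. B i j * A k i * A k j) / A k k"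
      unfolding sum_divide_distrib sum_subtractf[symmetric]
      by (intro sum.cong refl) (simp add: A'_def algebra_simps)
    moreover have "(\<Sum>j\<in>I. B k j * A k k * A k j) / A k k = (\<Sum>j\<in>I. A k j * B k j)"
      unfolding sum_divide_distrib using Akk by (intro sum.cong refl) simp
    moreover have "(\<Sum>i\<in>I. B i k * A k i * A k k) / A k k = (\<Sum>i\<in>I. A i k * B i k)"
      unfolding sum_divide_distrib
    proof (rule sum.cong)
      fix i
      show "B i k * A k i * A k k / A k k = A i k * B i k"
        using Akk sym[of i k] by simp
    qed simp
    ultimately show ?thesis
      unfolding split add_divide_distrib using Akk by simp
  qed
  ultimately show ?case by simp
qed

section \<open>Calculus: differentiability and the conditions at an interior maximum\<close>

text \<open>Move from x to y one coordinate at a time. On each segment the mean value inequality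
  applies, and continuity keeps the relevant partial derivative close to its value at x. This passes
  from the coordinatewise \<open>Ck_on\<close> to derivatives in every direction.\<close>

lemma has_derivative_partial_deriv:
  fixes f :: "real ^ 'n \<Rightarrow> real"
  assumes "open S" "x \<in> S"
    and part: "\<And>i y. y \<in> S \<Longrightarrow> has_partial_deriv_at i f y"
    and cont: "\<And>i. continuous_on S (partial_deriv i f)"
  shows "(f has_derivative (\<lambda>h. \<Sum>i\<in>UNIV. h $ i * partial_deriv i f x)) (at x)"
proof -
  \<comment> \<open>\<open>has_partial_deriv_at\<close> speaks only about the parameter value 0; a
    shift gives the derivative at every parameter s of the line.\<close>
  have line: "((\<lambda>t. f (z + t *\<^sub>R axis i 1)) has_real_derivative
      partial_deriv i f (z + s *\<^sub>R axis i 1)) (at s)" if "z + s *\<^sub>R axis i 1 \<in> S" for z s i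
  proof -
    have "((\<lambda>t. f ((z + s *\<^sub>R axis i 1) + t *\<^sub>R axis i 1)) has_real_derivative
      partial_deriv i f (z + s *\<^sub>R axis i 1)) (at 0)"
      using part[OF that, of i] unfolding has_partial_deriv_at_def partial_deriv_def
      by (simp add: DERIV_deriv_iff_field_differentiable)
    then have "((\<lambda>t. f (z + (t + s) *\<^sub>R axis i 1)) has_real_derivative
      partial_deriv i f (z + s *\<^sub>R axis i 1)) (at 0)"
      by (simp add: algebra_simps)
    then show ?thesis
      using DERIV_shift[of "\<lambda>t. f (z + t *\<^sub>R axis i 1)" _ 0 s] by simp
  qed
  show ?thesis
    unfolding has_derivative_at_alt
  proof (intro conjI allI impI)
    show "bounded_linear (\<lambda>h::real^'n. \<Sum>i\<in>UNIV. h $ i * partial_deriv i f x)"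
      by (intro bounded_linear_sum bounded_linear_mult_const bounded_linear_vec_nth)
  next
    fix e :: real assume "e > 0"
    \<comment> \<open>Each of the n coordinate moves costs at most \<epsilon> times the norm of h,
      for a total of e times that norm.\<close>
    define \<epsilon> where "\<epsilon> = e / CARD('n)"
    have "\<epsilon> > 0" using \<open>e > 0\<close> by (simp add: \<epsilon>_def)
    have "\<forall>i. \<exists>d>0. \<forall>y. dist y x < d \<longrightarrow> y \<in> S \<and> \<bar>partial_deriv i f y - partial_deriv i f x\<bar> < \<epsilon>"
    proof
      fix i
      have "isCont (partial_deriv i f) x"
        using cont[of i] \<open>open S\<close> \<open>x \<in> S\<close> continuous_on_eq_continuous_at by blast
      then obtain d1 where "d1 > 0" "\<forall>y. dist y x < d1 \<longrightarrow> \<bar>partial_deriv i f y - partial_deriv i f x\<bar> < \<epsilon>"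
        using \<open>\<epsilon> > 0\<close> unfolding continuous_at_eps_delta dist_real_def by blast
      moreover obtain d2 where "d2 > 0" "\<forall>y. dist y x < d2 \<longrightarrow> y \<in> S"
        using \<open>open S\<close> \<open>x \<in> S\<close> unfolding open_dist by blast
      ultimately show "\<exists>d>0. \<forall>y. dist y x < d \<longrightarrow> y \<in> S \<and> \<bar>partial_deriv i f y - partial_deriv i f x\<bar> < \<epsilon>"
        by (intro exI[of _ "min d1 d2"]) auto
    qed
    then obtain d where d: "\<And>i. d i > 0"
      "\<And>i y. dist y x < d i \<Longrightarrow> y \<in> S \<and> \<bar>partial_deriv i f y - partial_deriv i f x\<bar> < \<epsilon>"
      by metis
    define r where "r = Min (range d)"
    have r: "r > 0" "\<And>i. r \<le> d i"
      unfolding r_def using d(1) by auto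
    have "norm (f y - f x - (\<Sum>i\<in>UNIV. (y - x) $ i * partial_deriv i f x)) \<le> e * norm (y - x)"
      if y: "norm (y - x) < r" for y
    proof -
      define h where "h = y - x"
      \<comment> \<open>\<open>I\<close> is the set of coordinates already moved; the claim is the
        case of all coordinates.\<close>
      have step: "\<bar>f (x + (\<Sum>i\<in>I. h $ i *\<^sub>R axis i 1)) - f x - (\<Sum>i\<in>I. h $ i * partial_deriv i f x)\<bar>
          \<le> (\<Sum>i\<in>I. \<epsilon> * \<bar>h $ i\<bar>)" for I
        using finite[of I]
      proof (induction I rule: finite_induct)
        case empty
        then show ?case by simp
      next
        case (insert k I)
        define z where "z = x + (\<Sum>i\<in>I. h $ i *\<^sub>R axis i 1)"
        have comp: "(\<Sum>i\<in>I. h $ i *\<^sub>R axis i 1) $ j = (if j \<in> I then h $ j else 0)" for j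
          by (simp add: axis_def if_distrib cong: if_cong)
        \<comment> \<open>Since k is not in \<open>I\<close>, every component of the displacement
          from x is bounded by the same component of h, so the whole segment stays in the region
          where the partial derivatives are controlled.\<close>
        have near: "dist (z + t *\<^sub>R axis k 1) x < d i" if "\<bar>t\<bar> \<le> \<bar>h $ k\<bar>" for t i
        proof -
          have "norm ((\<Sum>i\<in>I. h $ i *\<^sub>R axis i 1) + t *\<^sub>R axis k 1 :: real ^ 'n) \<le> norm h"
          proof (rule norm_le_componentwise_cart)
            fix j
            have eq: "((\<Sum>i\<in>I. h $ i *\<^sub>R axis i 1) + t *\<^sub>R axis k 1) $ j =
                (if j \<in> I then h $ j else 0) + (if j = k then t else 0)"
              by (simp only: vector_add_component comp vector_scaleR_component) (simp add: axis_def)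
            show "norm (((\<Sum>i\<in>I. h $ i *\<^sub>R axis i 1) + t *\<^sub>R axis k 1 :: real ^ 'n) $ j) \<le> norm (h $ j)"
              unfolding eq using that insert.hyps by auto
          qed
          also have "\<dots> < r" using y by (simp add: h_def)
          also have "\<dots> \<le> d i" by (rule r)
          finally show ?thesis
            by (simp add: z_def dist_norm add_ac)
        qed
        have mvt: "\<bar>f (z + (h $ k) *\<^sub>R axis k 1) - f z - h $ k * partial_deriv k f x\<bar> \<le> \<epsilon> * \<bar>h $ k\<bar>"
        proof -
          \<comment> \<open>With the linear part subtracted, the derivative along the segment is at
            most \<epsilon> in absolute value.\<close>
          define \<phi> where "\<phi> t = f (z + t *\<^sub>R axis k 1) - t * partial_deriv k f x" for t
          have "norm (\<phi> (h $ k) - \<phi> 0) \<le> \<epsilon> * norm (h $ k - 0)"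
          proof (rule field_differentiable_bound[where S = "{- \<bar>h $ k\<bar> .. \<bar>h $ k\<bar>}"
              and f' = "\<lambda>t. partial_deriv k f (z + t *\<^sub>R axis k 1) - partial_deriv k f x"])
            fix t assume t: "t \<in> {- \<bar>h $ k\<bar> .. \<bar>h $ k\<bar>}"
            then have *: "dist (z + t *\<^sub>R axis k 1) x < d k"
              by (intro near) auto
            show "(\<phi> has_field_derivative partial_deriv k f (z + t *\<^sub>R axis k 1) - partial_deriv k f x)
                (at t within {- \<bar>h $ k\<bar> .. \<bar>h $ k\<bar>})"
              unfolding \<phi>_def
              by (rule derivative_eq_intros DERIV_subset[OF line] refl subset_UNIV |
                  use d(2)[OF *] in simp)+
            show "norm (partial_deriv k f (z + t *\<^sub>R axis k 1) - partial_deriv k f x) \<le> \<epsilon>"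
              using d(2)[OF *] by simp
          qed auto
          then show ?thesis by (simp add: \<phi>_def algebra_simps)
        qed
        have zk: "x + (\<Sum>i\<in>insert k I. h $ i *\<^sub>R axis i 1) = z + (h $ k) *\<^sub>R axis k 1"
          using insert.hyps by (simp add: z_def add_ac)
        then show ?case
          using insert.IH mvt insert.hyps unfolding zk by (simp add: z_def[symmetric])
      qed
      have hh: "(\<Sum>i\<in>UNIV. h $ i *\<^sub>R axis i 1) = h"
        by (simp add: vec_eq_iff axis_def if_distrib cong: if_cong)
      have "(\<Sum>i\<in>UNIV. \<epsilon> * \<bar>h $ i\<bar>) \<le> (\<Sum>i\<in>(UNIV::'n set). \<epsilon> * norm h)"
        using \<open>\<epsilon> > 0\<close> by (intro sum_mono mult_left_mono component_le_norm_cart) auto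
      also have "\<dots> = e * norm h" by (simp add: \<epsilon>_def)
      finally show ?thesis
        using step[of UNIV] unfolding hh by (simp add: h_def)
    qed
    then show "\<exists>d>0. \<forall>y. norm (y - x) < d \<longrightarrow>
        norm (f y - f x - (\<Sum>i\<in>UNIV. (y - x) $ i * partial_deriv i f x)) \<le> e * norm (y - x)"
      using r(1) by blast
  qed
qed

text \<open>A positive \<open>m\<close> would make \<open>f'\<close> positive just to the right of
  its zero at 0, and the mean value theorem would then give a value of f above
  \<open>f 0\<close>.\<close>

lemma local_max_second_derivative:
  fixes f :: "real \<Rightarrow> real"
  assumes "d > 0"
    and der: "\<And>t. \<bar>t\<bar> < d \<Longrightarrow> (f has_real_derivative f' t) (at t)"
    and der2: "(f' has_real_derivative m) (at 0)"
    and max: "\<And>t. \<bar>t\<bar> < d \<Longrightarrow> f t \<le> f 0"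
  shows "f' 0 = 0" and "m \<le> 0"
proof -
  show f'0: "f' 0 = 0"
    using DERIV_local_max[OF der \<open>d > 0\<close>] max \<open>d > 0\<close> by simp
  show "m \<le> 0"
  proof (rule ccontr)
    assume "\<not> m \<le> 0"
    then obtain e where e: "e > 0" "\<And>h. 0 < h \<Longrightarrow> h < e \<Longrightarrow> f' 0 < f' (0 + h)"
      using DERIV_pos_inc_right[OF der2] by (meson not_le)
    define t where "t = min e d / 2"
    have t: "0 < t" "t < e" "t < d" using e(1) \<open>d > 0\<close> by (auto simp: t_def)
    obtain z where z: "0 < z" "z < t" "f t - f 0 = (t - 0) * f' z"
      using MVT2[OF t(1), of f f'] der t by auto
    then have "f' z > 0" using e(2)[of z] t f'0 by simp
    then have "f t > f 0" using z t(1) by (simp add: zero_less_mult_iff algebra_simps)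
    with max[of t] t show False by simp
  qed
qed

text \<open>Restrict f to lines through p and use the one-dimensional conditions: coordinate
  directions give the gradient, arbitrary directions the Hessian form.\<close>

lemma local_max_gradient_hessian:
  fixes f :: "real ^ 'n \<Rightarrow> real"
  assumes "open S" "p \<in> S"
    and der: "\<And>z. z \<in> S \<Longrightarrow> (f has_derivative (\<lambda>h. \<Sum>i\<in>UNIV. h $ i * F i z)) (at z)"
    and der2: "\<And>j. (F j has_derivative (\<lambda>h. \<Sum>i\<in>UNIV. h $ i * K i j)) (at p)"
    and max: "\<And>z. z \<in> S \<Longrightarrow> f z \<le> f p"
  shows "F i p = 0" and "(\<Sum>i\<in>UNIV. \<Sum>j\<in>UNIV. K i j * \<xi> i * \<xi> j) \<le> 0"
proof -
  have *: "(\<Sum>i\<in>UNIV. v $ i * F i p) = 0 \<and> (\<Sum>j\<in>UNIV. v $ j * (\<Sum>i\<in>UNIV. v $ i * K i j)) \<le> 0" for v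
  proof -
    obtain r where r: "r > 0" "ball p r \<subseteq> S"
      using assms(1,2) openE by blast
    \<comment> \<open>The added 1 keeps the denominator positive when v is zero.\<close>
    define d where "d = r / (norm v + 1)"
    have n: "norm v + 1 > 0" by (smt (verit) norm_ge_zero)
    have "d > 0" using r n by (simp add: d_def)
    have inS: "p + t *\<^sub>R v \<in> S" if "\<bar>t\<bar> < d" for t
    proof -
      have "\<bar>t\<bar> * norm v \<le> \<bar>t\<bar> * (norm v + 1)" by (intro mult_left_mono) auto
      also have "\<dots> < r" using that n by (simp add: d_def field_simps)
      finally show ?thesis using r by (auto simp: dist_norm)
    qed
    have line: "((\<lambda>t. p + t *\<^sub>R v) has_derivative (\<lambda>s. s *\<^sub>R v)) (at t)" for t
      by (auto intro!: derivative_eq_intros)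
    let ?f' = "\<lambda>t. \<Sum>i\<in>UNIV. v $ i * F i (p + t *\<^sub>R v)"
    have 1: "((\<lambda>t. f (p + t *\<^sub>R v)) has_real_derivative ?f' t) (at t)" if "\<bar>t\<bar> < d" for t
      using has_derivative_compose[OF line[of t] der[OF inS[OF that]]]
      unfolding has_field_derivative_def
      by (rule has_derivative_eq_rhs) (simp add: fun_eq_iff sum_distrib_left mult_ac)
    have 2: "((\<lambda>t. F j (p + t *\<^sub>R v)) has_real_derivative (\<Sum>i\<in>UNIV. v $ i * K i j)) (at 0)" for j
    proof -
      have "((\<lambda>t. F j (p + t *\<^sub>R v)) has_derivative (\<lambda>s. \<Sum>i\<in>UNIV. (s *\<^sub>R v) $ i * K i j)) (at 0)"
        by (rule has_derivative_compose[OF line[of 0]]) (simp add: der2)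
      then show ?thesis
      unfolding has_field_derivative_def
      by (rule has_derivative_eq_rhs) (simp add: fun_eq_iff sum_distrib_left mult_ac)
    qed
    have 3: "(?f' has_real_derivative (\<Sum>j\<in>UNIV. v $ j * (\<Sum>i\<in>UNIV. v $ i * K i j))) (at 0)"
      by (intro DERIV_sum DERIV_cmult 2)
    have 4: "f (p + t *\<^sub>R v) \<le> f (p + 0 *\<^sub>R v)" if "\<bar>t\<bar> < d" for t
      using max[OF inS[OF that]] by simp
    show ?thesis
      using local_max_second_derivative[OF \<open>d > 0\<close> 1 3 4] by simp
  qed
  show "F i p = 0"
    using *[of "axis i 1"] by (simp add: axis_def if_distrib if_distribR cong: if_cong)
  have "(\<Sum>i\<in>UNIV. \<Sum>j\<in>UNIV. K i j * \<xi> i * \<xi> j) = (\<Sum>j\<in>UNIV. \<xi> j * (\<Sum>i\<in>UNIV. \<xi> i * K i j))"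
    unfolding sum_distrib_left by (subst sum.swap) (simp add: mult_ac)
  also have "\<dots> \<le> 0" using *[of "\<chi> i. \<xi> i"] by simp
  finally show "(\<Sum>i\<in>UNIV. \<Sum>j\<in>UNIV. K i j * \<xi> i * \<xi> j) \<le> 0" .
qed

section \<open>The exponential barrier and the maximum principle\<close>

text \<open>At a maximum of u + kE the gradient of u is that of -kE, and the Hessian of the sum has
  nonpositive trace against \<open>A\<close>. Hence the operator applied to u is at most -k times
  the operator applied to E. With w = p - y the latter equals 2 \<alpha> E (2 \<alpha> (Aw . w) - tr
  A - \<beta> . w), which \<open>large\<close> and ellipticity make positive.\<close>

lemma elliptic_neg_at_max_with_barrier:
  fixes u :: "real ^ 'n \<Rightarrow> real" and A :: "real ^ 'n ^ 'n" and \<beta> y :: "real ^ 'n" and \<alpha> :: real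
  defines "E \<equiv> \<lambda>z. exp (- \<alpha> * ((z - y) \<bullet> (z - y)))"
  assumes "open S" "p \<in> S"
    and der: "\<And>z. z \<in> S \<Longrightarrow> (u has_derivative (\<lambda>h. \<Sum>i\<in>UNIV. h $ i * G i z)) (at z)"
    and der2: "\<And>j. (G j has_derivative (\<lambda>h. \<Sum>i\<in>UNIV. h $ i * K i j)) (at p)"
    and max: "\<And>z. z \<in> S \<Longrightarrow> u z + k * E z \<le> u p + k * E p"
    and sym: "\<And>i j. A $ i $ j = A $ j $ i"
    and "\<mu> > 0"
    and ell: "\<And>\<xi> :: real ^ 'n. \<mu> * (norm \<xi>)\<^sup>2 \<le> (\<Sum>i\<in>UNIV. \<Sum>j\<in>UNIV. A $ i $ j * \<xi> $ i * \<xi> $ j)"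
    and "\<alpha> > 0" "k > 0"
    and large: "(\<Sum>i\<in>UNIV. A $ i $ i) + (\<Sum>i\<in>UNIV. \<beta> $ i * (p - y) $ i) < 2 * \<alpha> * \<mu> * (norm (p - y))\<^sup>2"
  shows "(\<Sum>i\<in>UNIV. \<Sum>j\<in>UNIV. A $ i $ j * K i j) + (\<Sum>i\<in>UNIV. \<beta> $ i * G i p) < 0"
proof -
  \<comment> \<open>\<open>F\<close> is the gradient of u + kE, and \<open>K'\<close> below is its
    Hessian at p, with the Kronecker symbol \<open>\<delta>\<close>.\<close>
  define F where "F i z = G i z - 2 * \<alpha> * k * E z * (z - y) $ i" for i z
  define w where "w = p - y"
  define \<delta> where "\<delta> i j = (if i = j then 1 else 0 :: real)" for i j :: 'n
  define K' where "K' i j = K i j + k * E p * (4 * \<alpha>\<^sup>2 * (w $ i * w $ j) - 2 * \<alpha> * \<delta> i j)" for i j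
  have E: "(E has_derivative (\<lambda>h. E z * (- \<alpha> * 2 * ((z - y) \<bullet> h)))) (at z)" for z
    unfolding E_def
    by (rule derivative_eq_intros refl)+ (simp add: fun_eq_iff inner_commute)
  have gder: "((\<lambda>z. u z + k * E z) has_derivative (\<lambda>h. \<Sum>i\<in>UNIV. h $ i * F i z)) (at z)"
    if "z \<in> S" for z
  proof -
    have "((\<lambda>z. u z + k * E z) has_derivative
        (\<lambda>h. (\<Sum>i\<in>UNIV. h $ i * G i z) + k * (E z * (- \<alpha> * 2 * ((z - y) \<bullet> h))))) (at z)"
      by (intro has_derivative_add der that has_derivative_mult_right E)
    then show ?thesis
      by (rule has_derivative_eq_rhs)
        (simp add: F_def fun_eq_iff inner_vec_def right_diff_distrib sum_subtractf sum_negf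
          sum_distrib_left mult_ac)
  qed
  have Fder: "(F j has_derivative (\<lambda>h. \<Sum>i\<in>UNIV. h $ i * K' i j)) (at p)" for j
  proof -
    have 1: "((\<lambda>z. (z - y) $ j) has_derivative (\<lambda>h. h $ j)) (at p)"
      by (auto intro!: derivative_eq_intros bounded_linear_imp_has_derivative bounded_linear_vec_nth)
    have "(F j has_derivative
        (\<lambda>h. (\<Sum>i\<in>UNIV. h $ i * K i j) - 2 * \<alpha> * k * (E p * h $ j + (E p * (- \<alpha> * 2 * ((p - y) \<bullet> h))) * (p - y) $ j)))
        (at p)"
      unfolding F_def mult.assoc[of _ "E _"]
      by (intro has_derivative_diff der2 has_derivative_mult_right has_derivative_mult E 1)
    moreover have "(\<Sum>i\<in>UNIV. h $ i * K' i j) =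
       (\<Sum>i\<in>UNIV. h $ i * K i j) + 4 * \<alpha>\<^sup>2 * k * E p * w $ j * (w \<bullet> h) - 2 * \<alpha> * k * E p * h $ j"
      for h :: "real ^ 'n"
    proof -
      have "(\<Sum>i\<in>UNIV. h $ i * K' i j) = (\<Sum>i\<in>UNIV. h $ i * K i j
          + (4 * \<alpha>\<^sup>2 * k * E p * w $ j) * (w $ i * h $ i) - (2 * \<alpha> * k * E p) * (h $ i * \<delta> i j))"
        by (intro sum.cong refl) (simp add: K'_def algebra_simps)
      also have "\<dots> = (\<Sum>i\<in>UNIV. h $ i * K i j) + (4 * \<alpha>\<^sup>2 * k * E p * w $ j) * (\<Sum>i\<in>UNIV. w $ i * h $ i)
          - (2 * \<alpha> * k * E p) * (\<Sum>i\<in>UNIV. h $ i * \<delta> i j)"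
        by (simp only: sum.distrib sum_subtractf flip: sum_distrib_left)
      also have "(\<Sum>i\<in>UNIV. h $ i * \<delta> i j) = h $ j"
        by (simp add: \<delta>_def if_distrib cong: if_cong)
      finally show ?thesis by (simp add: inner_vec_def)
    qed
    ultimately show ?thesis
      by (elim has_derivative_eq_rhs) (simp add: fun_eq_iff w_def algebra_simps power2_eq_square)
  qed
  have grad: "G i p = 2 * \<alpha> * k * E p * w $ i" for i
    using local_max_gradient_hessian(1)[OF \<open>open S\<close> \<open>p \<in> S\<close> gder Fder max, of i]
    by (simp add: F_def w_def)
  have hess: "(\<Sum>i\<in>UNIV. \<Sum>j\<in>UNIV. K' i j * \<xi> i * \<xi> j) \<le> 0" for \<xi>
    by (rule local_max_gradient_hessian(2)[OF \<open>open S\<close> \<open>p \<in> S\<close> gder Fder max])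
  \<comment> \<open>The Hessian form is nonpositive at the maximum, so the trace inequality applies
    to \<open>A\<close> and \<open>- K'\<close>.\<close>
  have "0 \<le> (\<Sum>i\<in>UNIV. \<Sum>j\<in>UNIV. A $ i $ j * - K' i j)"
  proof (rule sum_posdef_times_psd_nonneg)
    fix v :: "'n \<Rightarrow> real"
    assume "\<exists>i\<in>UNIV. v i \<noteq> 0"
    then have "(\<chi> i. v i) \<noteq> 0" by (simp add: vec_eq_iff)
    then have "0 < \<mu> * (norm (\<chi> i. v i))\<^sup>2" using \<open>\<mu> > 0\<close> by simp
    also have "\<dots> \<le> (\<Sum>i\<in>UNIV. \<Sum>j\<in>UNIV. A $ i $ j * v i * v j)"
      using ell[of "\<chi> i. v i"] by simp
    finally show "0 < (\<Sum>i\<in>UNIV. \<Sum>j\<in>UNIV. A $ i $ j * v i * v j)" .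
  qed (use sym hess in \<open>auto simp: sum_negf\<close>)
  then have "(\<Sum>i\<in>UNIV. \<Sum>j\<in>UNIV. A $ i $ j * K' i j) \<le> 0"
    by (simp add: sum_negf)
  moreover have "(\<Sum>i\<in>UNIV. \<Sum>j\<in>UNIV. A $ i $ j * K' i j) =
      (\<Sum>i\<in>UNIV. \<Sum>j\<in>UNIV. A $ i $ j * K i j) +
      k * E p * (4 * \<alpha>\<^sup>2 * (\<Sum>i\<in>UNIV. \<Sum>j\<in>UNIV. A $ i $ j * w $ i * w $ j) - 2 * \<alpha> * (\<Sum>i\<in>UNIV. A $ i $ i))"
  proof -
    have "(\<Sum>i\<in>UNIV. \<Sum>j\<in>UNIV. A $ i $ j * K' i j) =
        (\<Sum>i\<in>UNIV. \<Sum>j\<in>UNIV. A $ i $ j * K i j + (4 * \<alpha>\<^sup>2 * k * E p) * (A $ i $ j * w $ i * w $ j)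
          - (2 * \<alpha> * k * E p) * (A $ i $ j * \<delta> i j))"
      by (intro sum.cong refl) (simp add: K'_def algebra_simps)
    also have "\<dots> = (\<Sum>i\<in>UNIV. \<Sum>j\<in>UNIV. A $ i $ j * K i j)
        + (4 * \<alpha>\<^sup>2 * k * E p) * (\<Sum>i\<in>UNIV. \<Sum>j\<in>UNIV. A $ i $ j * w $ i * w $ j)
        - (2 * \<alpha> * k * E p) * (\<Sum>i\<in>UNIV. \<Sum>j\<in>UNIV. A $ i $ j * \<delta> i j)"
      by (simp only: sum.distrib sum_subtractf flip: sum_distrib_left)
    also have "(\<Sum>i\<in>UNIV. \<Sum>j\<in>UNIV. A $ i $ j * \<delta> i j) = (\<Sum>i\<in>UNIV. A $ i $ i)"
      by (simp add: \<delta>_def if_distrib cong: if_cong)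
    finally show ?thesis by (simp add: algebra_simps)
  qed
  ultimately have 1: "(\<Sum>i\<in>UNIV. \<Sum>j\<in>UNIV. A $ i $ j * K i j) \<le>
      - (k * E p * (4 * \<alpha>\<^sup>2 * (\<Sum>i\<in>UNIV. \<Sum>j\<in>UNIV. A $ i $ j * w $ i * w $ j) - 2 * \<alpha> * (\<Sum>i\<in>UNIV. A $ i $ i)))"
    by simp
  have 2: "(\<Sum>i\<in>UNIV. \<beta> $ i * G i p) = k * E p * (2 * \<alpha> * (\<Sum>i\<in>UNIV. \<beta> $ i * w $ i))"
    unfolding grad sum_distrib_left by (simp add: mult_ac)
  \<comment> \<open>From here on: the barrier is a strict subsolution at p. The square of \<alpha>
    in the second-order term outweighs the trace and drift terms, which are linear in
    \<alpha>.\<close>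
  have "2 * \<alpha> * ((\<Sum>i\<in>UNIV. A $ i $ i) + (\<Sum>i\<in>UNIV. \<beta> $ i * w $ i)) < 2 * \<alpha> * (2 * \<alpha> * \<mu> * (norm w)\<^sup>2)"
    using large \<open>\<alpha> > 0\<close> unfolding w_def by (intro mult_strict_left_mono) auto
  also have "\<dots> = 4 * \<alpha>\<^sup>2 * (\<mu> * (norm w)\<^sup>2)" by (simp add: power2_eq_square)
  also have "\<dots> \<le> 4 * \<alpha>\<^sup>2 * (\<Sum>i\<in>UNIV. \<Sum>j\<in>UNIV. A $ i $ j * w $ i * w $ j)"
    by (intro mult_left_mono ell) auto
  finally have "0 < k * E p * (4 * \<alpha>\<^sup>2 * (\<Sum>i\<in>UNIV. \<Sum>j\<in>UNIV. A $ i $ j * w $ i * w $ j)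
      - 2 * \<alpha> * (\<Sum>i\<in>UNIV. A $ i $ i) - 2 * \<alpha> * (\<Sum>i\<in>UNIV. \<beta> $ i * w $ i))"
    using \<open>k > 0\<close> by (intro mult_pos_pos) (auto simp: E_def distrib_left)
  then show ?thesis
    using 1 unfolding 2 by (simp add: right_diff_distrib)
qed

text \<open>The one-sided form serves both u and -u. The derivatives are arbitrary families
  \<open>G\<close> and \<open>K\<close>, so for -u they are simply negated and no
  \<open>partial_deriv\<close> has to be recomputed.\<close>

lemma bounded_subsolution_nonpos:
  fixes a :: "real ^ 'n \<Rightarrow> real ^ 'n ^ 'n" and b :: "real ^ 'n \<Rightarrow> real ^ 'n"
    and c u :: "real ^ 'n \<Rightarrow> real"
  assumes "open \<Omega>"
    and sym: "\<And>x i j. x \<in> \<Omega> \<Longrightarrow> a x $ i $ j = a x $ j $ i"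
    and "\<mu> > 0"
    and ell: "\<And>x \<xi>. x \<in> \<Omega> \<Longrightarrow>
        \<mu> * (norm \<xi>)\<^sup>2 \<le> (\<Sum>i\<in>UNIV. \<Sum>j\<in>UNIV. a x $ i $ j * \<xi> $ i * \<xi> $ j)"
    and a_le: "\<And>x i j. x \<in> \<Omega> \<Longrightarrow> \<bar>a x $ i $ j\<bar> \<le> H"
    and b_le: "\<And>x i. x \<in> \<Omega> \<Longrightarrow> \<bar>b x $ i\<bar> \<le> H"
    and c_le: "\<And>x. x \<in> \<Omega> \<Longrightarrow> c x \<le> 0"
    and thick: "\<And>x. x \<in> \<Omega> \<Longrightarrow> \<exists>y\<in>frontier \<Omega>. dist x y < D"
    and der: "\<And>x. x \<in> \<Omega> \<Longrightarrow> (u has_derivative (\<lambda>h. \<Sum>i\<in>UNIV. h $ i * G i x)) (at x)"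
    and der2: "\<And>x j. x \<in> \<Omega> \<Longrightarrow> (G j has_derivative (\<lambda>h. \<Sum>i\<in>UNIV. h $ i * K i j x)) (at x)"
    and pde: "\<And>x. x \<in> \<Omega> \<Longrightarrow> 0 \<le> (\<Sum>i\<in>UNIV. \<Sum>j\<in>UNIV. a x $ i $ j * K i j x)
        + (\<Sum>i\<in>UNIV. b x $ i * G i x) + c x * u x"
    and cont: "continuous_on (closure \<Omega>) u"
    and bdd: "bdd_above (u ` \<Omega>)"
    and bdry: "\<And>x. x \<in> frontier \<Omega> \<Longrightarrow> u x \<le> 0"
    and near: "\<And>\<epsilon>. \<epsilon> > 0 \<Longrightarrow> \<exists>\<delta>>0. \<forall>x\<in>\<Omega>. (\<exists>y\<in>frontier \<Omega>. dist x y < \<delta>) \<longrightarrow> u x \<le> \<epsilon>"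
    and "x \<in> \<Omega>"
  shows "u x \<le> 0"
proof (rule ccontr)
  assume "\<not> u x \<le> 0"
  define M where "M = (SUP x\<in>\<Omega>. u x)"
  have u_le: "u z \<le> M" if "z \<in> \<Omega>" for z
    unfolding M_def using bdd that by (rule cSUP_upper2[OF _ _ order_refl])
  have "M > 0" using \<open>\<not> u x \<le> 0\<close> u_le[OF \<open>x \<in> \<Omega>\<close>] by simp
  \<comment> \<open>The level M/2 matches the barrier, which adds at most M/2: within \<delta> of
    the boundary the sum stays below M.\<close>
  then obtain \<delta> where \<delta>: "\<delta> > 0" "\<And>z y. z \<in> \<Omega> \<Longrightarrow> y \<in> frontier \<Omega> \<Longrightarrow> dist z y < \<delta> \<Longrightarrow> u z \<le> M / 2"
    using near[of "M / 2"] by auto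
  have "D > 0" using thick[OF \<open>x \<in> \<Omega>\<close>] by (metis dist_not_less_zero le_less_trans linorder_not_le)
  have "H \<ge> 0" using a_le[OF \<open>x \<in> \<Omega>\<close>] by (meson abs_ge_zero order_trans)
  \<comment> \<open>R exceeds D so that the barrier is strictly larger at distance D than on the
    sphere of radius R; this gap is what \<open>\<eta>\<close> measures.\<close>
  define R where "R = D + 1"
  \<comment> \<open>Bounds the trace of a plus the drift term b . (p - y) within distance R of y: n
    entries at most H and n products at most HR.\<close>
  define N where "N = CARD('n) * H * (1 + R)"
  have "N \<ge> 0" using \<open>H \<ge> 0\<close> \<open>D > 0\<close> by (simp add: N_def R_def)
  \<comment> \<open>Chosen so that 2 \<alpha> \<mu> times the square of \<delta> equals N +
    1.\<close>
  define \<alpha> where "\<alpha> = (N + 1) / (2 * \<mu> * \<delta>\<^sup>2)"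
  have "\<alpha> > 0" using \<open>N \<ge> 0\<close> \<open>\<mu> > 0\<close> \<delta>(1) by (simp add: \<alpha>_def)
  have \<alpha>_large: "N < 2 * \<alpha> * \<mu> * \<delta>\<^sup>2" using \<open>\<mu> > 0\<close> \<delta>(1) by (simp add: \<alpha>_def)
  define \<eta> where "\<eta> = M / 2 * (exp (- \<alpha> * D\<^sup>2) - exp (- \<alpha> * R\<^sup>2))"
  have "D\<^sup>2 < R\<^sup>2" using \<open>D > 0\<close> by (simp add: R_def power_strict_mono)
  then have "\<eta> > 0" using \<open>M > 0\<close> \<open>\<alpha> > 0\<close> by (simp add: \<eta>_def)
  have "u q \<le> M - \<eta>" if q: "q \<in> \<Omega>" for q
  proof -
    obtain y where y: "y \<in> frontier \<Omega>" "dist q y < D" using thick[OF q] by blast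
    define E where "E z = exp (- \<alpha> * ((z - y) \<bullet> (z - y)))" for z
    define g where "g z = u z + M / 2 * E z" for z
    have E_norm: "E z = exp (- \<alpha> * (dist z y)\<^sup>2)" for z
      by (simp add: E_def dist_norm power2_norm_eq_inner)
    have E_le: "E z \<le> 1" for z
      using \<open>\<alpha> > 0\<close> by (simp add: E_norm)
    define S where "S = closure \<Omega> \<inter> cball y R"
    have "q \<in> S" using q y closure_subset by (auto simp: S_def R_def dist_commute)
    moreover have "compact S" unfolding S_def by (intro closed_Int_compact) auto
    moreover have "continuous_on S g"
      unfolding g_def E_def using continuous_on_subset[OF cont, of S]
      by (auto simp: S_def intro!: continuous_intros)
    ultimately obtain p where p: "p \<in> S" "\<And>z. z \<in> S \<Longrightarrow> g z \<le> g p"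
      using continuous_attains_sup[of S g] by blast
    have "g p \<le> M + M / 2 * exp (- \<alpha> * R\<^sup>2)"
    proof -
      \<comment> \<open>The sphere gives the asserted bound directly. Boundary points, points within
        \<delta> of y and points with u < 0 even give at most M. The last case is an interior
        maximum and is contradictory.\<close>
      consider "p \<notin> \<Omega>" | "p \<in> \<Omega>" "dist p y = R" | "p \<in> \<Omega>" "dist p y < \<delta>" | "p \<in> \<Omega>" "u p < 0"
        | "p \<in> \<Omega>" "\<delta> \<le> dist p y" "dist p y < R" "u p \<ge> 0"
        using p(1) by (force simp: S_def dist_commute)
      then show ?thesis
      proof cases
        case 1
        then have "p \<in> frontier \<Omega>" using p(1) \<open>open \<Omega>\<close> by (simp add: S_def frontier_def interior_open)
        then have "u p \<le> 0" by (rule bdry)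
        then show ?thesis using E_le[of p] \<open>M > 0\<close> unfolding g_def
          by (smt (verit) exp_gt_zero field_sum_of_halves mult_left_le mult_pos_pos)
      next
        case 2
        then show ?thesis using u_le[of p] by (simp add: g_def E_norm)
      next
        case 3
        then have "u p \<le> M / 2" using \<delta>(2) y(1) by blast
        then show ?thesis using E_le[of p] \<open>M > 0\<close> unfolding g_def
          by (smt (verit) exp_gt_zero field_sum_of_halves mult_left_le mult_pos_pos)
      next
        case 4
        then show ?thesis using E_le[of p] \<open>M > 0\<close> unfolding g_def
          by (smt (verit) exp_gt_zero field_sum_of_halves mult_left_le mult_pos_pos)
      next
        case 5
        have "(\<Sum>i\<in>UNIV. a p $ i $ i) \<le> (\<Sum>i\<in>(UNIV::'n set). H)"
          using a_le[OF 5(1)] by (intro sum_mono) (meson abs_le_D1)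
        moreover have "(\<Sum>i\<in>UNIV. b p $ i * (p - y) $ i) \<le> (\<Sum>i\<in>(UNIV::'n set). H * R)"
        proof (rule sum_mono)
          fix i
          have "b p $ i * (p - y) $ i \<le> \<bar>b p $ i\<bar> * \<bar>(p - y) $ i\<bar>"
            by (metis abs_ge_self abs_mult)
          also have "\<dots> \<le> H * R"
            using b_le[OF 5(1), of i] component_le_norm_cart[of "p - y" i] 5(3) \<open>H \<ge> 0\<close>
            by (intro mult_mono) (auto simp: dist_norm)
          finally show "b p $ i * (p - y) $ i \<le> H * R" .
        qed
        moreover have "2 * \<alpha> * \<mu> * \<delta>\<^sup>2 \<le> 2 * \<alpha> * \<mu> * (norm (p - y))\<^sup>2"
          using 5(2) \<delta>(1) \<open>\<alpha> > 0\<close> \<open>\<mu> > 0\<close> by (intro mult_left_mono power_mono) (auto simp: dist_norm)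
        ultimately have large: "(\<Sum>i\<in>UNIV. a p $ i $ i) + (\<Sum>i\<in>UNIV. b p $ i * (p - y) $ i)
            < 2 * \<alpha> * \<mu> * (norm (p - y))\<^sup>2"
          using \<alpha>_large by (simp add: N_def algebra_simps)
        have "(\<Sum>i\<in>UNIV. \<Sum>j\<in>UNIV. a p $ i $ j * K i j p) + (\<Sum>i\<in>UNIV. b p $ i * G i p) < 0"
        proof (rule elliptic_neg_at_max_with_barrier[where S = "\<Omega> \<inter> ball y R" and u = u and k = "M / 2"])
          show "u z + M / 2 * exp (- \<alpha> * ((z - y) \<bullet> (z - y)))
              \<le> u p + M / 2 * exp (- \<alpha> * ((p - y) \<bullet> (p - y)))" if "z \<in> \<Omega> \<inter> ball y R" for z
            using p(2)[of z] that closure_subset[of \<Omega>] by (auto simp: S_def g_def E_def)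
        qed (use \<open>open \<Omega>\<close> 5 der der2 sym ell large \<open>\<mu> > 0\<close> \<open>\<alpha> > 0\<close> \<open>M > 0\<close> in \<open>auto simp: dist_commute\<close>)
        \<comment> \<open>Since c is nonpositive and u is nonnegative at p, the zero-order term
          cannot compensate the negative second- and first-order part.\<close>
        moreover have "c p * u p \<le> 0"
          using c_le[OF 5(1)] 5(4) by (simp add: mult_nonpos_nonneg)
        ultimately show ?thesis using pde[OF 5(1)] by simp
      qed
    qed
    \<comment> \<open>As q is closer to y than D, the barrier at q is at least its value at distance
      D; comparing with the bound at p leaves exactly \<open>\<eta>\<close>.\<close>
    moreover have "u q + M / 2 * exp (- \<alpha> * D\<^sup>2) \<le> g q"
      using y(2) \<open>M > 0\<close> \<open>\<alpha> > 0\<close> by (simp add: g_def E_norm power_mono)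
    ultimately show ?thesis
      using p(2)[OF \<open>q \<in> S\<close>] by (simp add: \<eta>_def right_diff_distrib)
  qed
  then have "M \<le> M - \<eta>"
    unfolding M_def using \<open>x \<in> \<Omega>\<close> by (intro cSUP_least) auto
  with \<open>\<eta> > 0\<close> show False by simp
qed

section \<open>From the definitions of the statement to the theorem\<close>

lemma Ck_on_2_has_derivatives:
  assumes "open S" "Ck_on 2 S u" "x \<in> S"
  shows "(u has_derivative (\<lambda>h. \<Sum>i\<in>UNIV. h $ i * partial_deriv i u x)) (at x)"
    and "(partial_deriv j u has_derivative
          (\<lambda>h. \<Sum>i\<in>UNIV. h $ i * partial_deriv i (partial_deriv j u) x)) (at x)"
  using assms
  by (auto intro!: has_derivative_partial_deriv[of S] simp: numeral_2_eq_2)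

lemma abs_le_C0_norm: "x \<in> S \<Longrightarrow> ereal \<bar>f x\<bar> \<le> C0_norm S f"
  unfolding C0_norm_def by (rule SUP_upper)

lemma abs_le_of_C0_norm_sum_le:
  assumes "C0_norm S f + C0_norm S g + C0_norm S h \<le> ereal H" "x \<in> S"
  shows "\<bar>f x\<bar> \<le> H" "\<bar>g x\<bar> \<le> H"
proof -
  have "ereal \<bar>f x\<bar> + ereal \<bar>g x\<bar> + ereal \<bar>h x\<bar> \<le> ereal H"
    using assms by (meson add_mono abs_le_C0_norm order_trans)
  then have "\<bar>f x\<bar> + \<bar>g x\<bar> + \<bar>h x\<bar> \<le> H" by simp
  then show "\<bar>f x\<bar> \<le> H" "\<bar>g x\<bar> \<le> H" by linarith+
qed

text \<open>A strict upper bound on an infimum is witnessed by a boundary point whether or not the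
  infimum is attained. An empty frontier gives infinity, so a finite bound also shows that there is
  a boundary.\<close>

lemma boundary_dist_less_iff:
  "boundary_dist \<Omega> x < ereal d \<longleftrightarrow> (\<exists>y\<in>frontier \<Omega>. dist x y < d)"
  by (simp add: boundary_dist_def INF_less_iff)

text \<open>Turns the sequential condition c) into a uniform one: were it to fail at every scale
  1/(k+1), the counterexamples would form a sequence approaching the boundary along which u stays
  away from 0.\<close>

lemma small_near_boundary:
  fixes u :: "real ^ 'n \<Rightarrow> real"
  assumes lim: "\<And>x :: nat \<Rightarrow> real ^ 'n. (\<And>k. x k \<in> \<Omega>) \<Longrightarrow>
      (\<lambda>k. boundary_dist \<Omega> (x k)) \<longlonglongrightarrow> 0 \<Longrightarrow> (\<lambda>k. u (x k)) \<longlonglongrightarrow> 0"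
    and "\<epsilon> > 0"
  shows "\<exists>\<delta>>0. \<forall>x\<in>\<Omega>. (\<exists>y\<in>frontier \<Omega>. dist x y < \<delta>) \<longrightarrow> \<bar>u x\<bar> \<le> \<epsilon>"
proof (rule ccontr)
  assume contra: "\<not> ?thesis"
  have "\<exists>x\<in>\<Omega>. (\<exists>y\<in>frontier \<Omega>. dist x y < inverse (real (Suc k))) \<and> \<epsilon> < \<bar>u x\<bar>" for k
    using contra by (force simp: not_le)
  then obtain x where x: "\<And>k. x k \<in> \<Omega>" "\<And>k. boundary_dist \<Omega> (x k) < ereal (inverse (real (Suc k)))"
      "\<And>k. \<epsilon> < \<bar>u (x k)\<bar>"
    unfolding boundary_dist_less_iff by metis
  have "(\<lambda>k. boundary_dist \<Omega> (x k)) \<longlonglongrightarrow> 0"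
  proof (rule tendsto_sandwich)
    show "\<forall>\<^sub>F k in sequentially. 0 \<le> boundary_dist \<Omega> (x k)"
      by (simp add: boundary_dist_def le_INF_iff)
    show "\<forall>\<^sub>F k in sequentially. boundary_dist \<Omega> (x k) \<le> ereal (inverse (real (Suc k)))"
      using x(2) by (simp add: less_imp_le)
    show "(\<lambda>k. ereal (inverse (real (Suc k)))) \<longlonglongrightarrow> 0"
      using LIMSEQ_inverse_real_of_nat by (simp add: zero_ereal_def)
  qed simp
  then have "(\<lambda>k. u (x k)) \<longlonglongrightarrow> 0" using x(1) by (intro lim)
  then obtain k where "\<bar>u (x k)\<bar> < \<epsilon>"
    using \<open>\<epsilon> > 0\<close> unfolding LIMSEQ_iff by fastforce
  with x(3)[of k] show False by simp
qed

theorem theorem1: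
  fixes \<Omega> :: "(real ^ 'n) set"
    and a :: "real ^ 'n \<Rightarrow> real ^ 'n ^ 'n"
    and b :: "real ^ 'n \<Rightarrow> real ^ 'n"
    and c u :: "real ^ 'n \<Rightarrow> real"
    and H \<Lambda> :: real
  assumes "domain \<Omega>" and "\<not> bounded \<Omega>"
    and "\<And>i j. continuous_on (closure \<Omega>) (\<lambda>x. a x $ i $ j)"
    and "\<And>i. continuous_on (closure \<Omega>) (\<lambda>x. b x $ i)"
    and "continuous_on (closure \<Omega>) c"
    and "\<And>x. x \<in> closure \<Omega> \<Longrightarrow> transpose (a x) = a x \<and> pos_def_matrix (a x)"
    and "\<And>i j. C0_norm \<Omega> (\<lambda>x. a x $ i $ j) + C0_norm \<Omega> (\<lambda>x. b x $ i) + C0_norm \<Omega> c \<le> ereal H"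
    and "\<And>x. x \<in> \<Omega> \<Longrightarrow> c x \<le> 0"
    and "\<And>x \<xi>. x \<in> \<Omega> \<Longrightarrow>
           1 / \<Lambda> * (norm \<xi>)\<^sup>2 \<le> (\<Sum>i\<in>UNIV. \<Sum>j\<in>UNIV. a x $ i $ j * \<xi> $ i * \<xi> $ j) \<and>
           (\<Sum>i\<in>UNIV. \<Sum>j\<in>UNIV. a x $ i $ j * \<xi> $ i * \<xi> $ j) \<le> \<Lambda> * (norm \<xi>)\<^sup>2"
    and "(SUP x\<in>\<Omega>. boundary_dist \<Omega> x) < \<infinity>"
    and "Ck_on 2 \<Omega> u" and "continuous_on (closure \<Omega>) u" and "bounded (u ` \<Omega>)"
    and "\<And>x. x \<in> \<Omega> \<Longrightarrow>
           (\<Sum>i\<in>UNIV. \<Sum>j\<in>UNIV. a x $ i $ j * partial_deriv i (partial_deriv j u) x)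
           + (\<Sum>i\<in>UNIV. b x $ i * partial_deriv i u x) + c x * u x = 0"
    and "\<And>x. x \<in> frontier \<Omega> \<Longrightarrow> u x = 0"
    and "\<And>x :: nat \<Rightarrow> real ^ 'n. (\<And>k. x k \<in> \<Omega>) \<Longrightarrow>
           (\<lambda>k. boundary_dist \<Omega> (x k)) \<longlonglongrightarrow> 0 \<Longrightarrow> (\<lambda>k. u (x k)) \<longlonglongrightarrow> 0"
  shows "\<forall>x\<in>\<Omega>. u x = 0"
proof
  fix q assume "q \<in> \<Omega>"
  have "open \<Omega>" using assms(1) by (simp add: domain_def)
  have sub: "x \<in> closure \<Omega>" if "x \<in> \<Omega>" for x using that closure_subset by blast
  have sym: "a x $ i $ j = a x $ j $ i" if "x \<in> \<Omega>" for x i j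
    using assms(6)[OF sub[OF that]] by (simp add: transpose_def vec_eq_iff)
  \<comment> \<open>Test the form at q on a unit coordinate vector, \<open>undefined\<close> being
    an arbitrary index: it is positive by positive definiteness and at most \<Lambda>.\<close>
  have "\<Lambda> > 0"
  proof -
    have form: "v \<bullet> (a q *v v) = (\<Sum>i\<in>UNIV. \<Sum>j\<in>UNIV. a q $ i $ j * v $ i * v $ j)" for v
      by (simp add: inner_vec_def matrix_vector_mult_def sum_distrib_left mult_ac)
    have "0 < axis undefined 1 \<bullet> (a q *v axis undefined 1)"
      using assms(6)[OF sub[OF \<open>q \<in> \<Omega>\<close>]] by (simp add: pos_def_matrix_def)
    also have "\<dots> \<le> \<Lambda> * (norm (axis undefined 1 :: real ^ 'n))\<^sup>2"
      unfolding form using assms(9)[OF \<open>q \<in> \<Omega>\<close>] by blast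
    finally show ?thesis by simp
  qed
  \<comment> \<open>Taking D strictly above the supremum gives every point a boundary point at
    distance less than D.\<close>
  obtain D where D: "(SUP x\<in>\<Omega>. boundary_dist \<Omega> x) < ereal D"
    using assms(10) less_PInf_Ex_of_nat by force
  have thick: "\<exists>y\<in>frontier \<Omega>. dist x y < D" if "x \<in> \<Omega>" for x
    using le_less_trans[OF SUP_upper[OF that] D] by (simp add: boundary_dist_less_iff)
  obtain B where B: "\<And>x. x \<in> \<Omega> \<Longrightarrow> \<bar>u x\<bar> \<le> B"
    using assms(13) unfolding bounded_iff by auto
  note der = Ck_on_2_has_derivatives[OF \<open>open \<Omega>\<close> assms(11)]
  have small: "\<exists>\<delta>>0. \<forall>x\<in>\<Omega>. (\<exists>y\<in>frontier \<Omega>. dist x y < \<delta>) \<longrightarrow> \<bar>u x\<bar> \<le> \<epsilon>"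
    if "\<epsilon> > 0" for \<epsilon>
    by (rule small_near_boundary[OF _ that]) (rule assms(16))
  note bounds = abs_le_of_C0_norm_sum_le[OF assms(7)]
  have "u q \<le> 0"
  proof (rule bounded_subsolution_nonpos[where \<Omega> = \<Omega> and a = a and b = b and c = c and u = u
        and \<mu> = "1 / \<Lambda>" and H = H and D = D])
    show "0 < 1 / \<Lambda>" using \<open>\<Lambda> > 0\<close> by simp
    show "bdd_above (u ` \<Omega>)" using B by (intro bdd_aboveI2[where M = B]) (meson abs_le_D1)
    show "\<exists>\<delta>>0. \<forall>x\<in>\<Omega>. (\<exists>y\<in>frontier \<Omega>. dist x y < \<delta>) \<longrightarrow> u x \<le> \<epsilon>" if "\<epsilon> > 0" for \<epsilon>
      using small[OF that] by (meson abs_le_D1)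
    show "0 \<le> (\<Sum>i\<in>UNIV. \<Sum>j\<in>UNIV. a x $ i $ j * partial_deriv i (partial_deriv j u) x)
        + (\<Sum>i\<in>UNIV. b x $ i * partial_deriv i u x) + c x * u x" if "x \<in> \<Omega>" for x
      using assms(14)[OF that] by simp
  qed (use \<open>open \<Omega>\<close> sym assms(8,9,12,15) bounds thick der \<open>q \<in> \<Omega>\<close> in auto)
  \<comment> \<open>The equation is linear and the boundary conditions are symmetric in sign, so the
    same argument runs for -u.\<close>
  moreover have "- u q \<le> 0"
  proof (rule bounded_subsolution_nonpos[where \<Omega> = \<Omega> and a = a and b = b and c = c and u = "\<lambda>x. - u x"
        and \<mu> = "1 / \<Lambda>" and H = H and D = D])
    show "0 < 1 / \<Lambda>" using \<open>\<Lambda> > 0\<close> by simp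
    show "bdd_above ((\<lambda>x. - u x) ` \<Omega>)" using B by (intro bdd_aboveI2[where M = B]) (meson abs_le_D2)
    show "\<exists>\<delta>>0. \<forall>x\<in>\<Omega>. (\<exists>y\<in>frontier \<Omega>. dist x y < \<delta>) \<longrightarrow> - u x \<le> \<epsilon>" if "\<epsilon> > 0" for \<epsilon>
      using small[OF that] by (meson abs_le_D2)
    show "((\<lambda>x. - u x) has_derivative (\<lambda>h. \<Sum>i\<in>UNIV. h $ i * - partial_deriv i u x)) (at x)"
      if "x \<in> \<Omega>" for x
      using has_derivative_minus[OF der(1)[OF that]] by (simp add: sum_negf)
    show "((\<lambda>x. - partial_deriv j u x) has_derivative
        (\<lambda>h. \<Sum>i\<in>UNIV. h $ i * - partial_deriv i (partial_deriv j u) x)) (at x)"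
      if "x \<in> \<Omega>" for x j
      using has_derivative_minus[OF der(2)[OF that]] by (simp add: sum_negf)
    show "0 \<le> (\<Sum>i\<in>UNIV. \<Sum>j\<in>UNIV. a x $ i $ j * - partial_deriv i (partial_deriv j u) x)
        + (\<Sum>i\<in>UNIV. b x $ i * - partial_deriv i u x) + c x * - u x" if "x \<in> \<Omega>" for x
      using assms(14)[OF that] by (simp add: sum_negf)
    show "continuous_on (closure \<Omega>) (\<lambda>x. - u x)"
      using assms(12) by (rule continuous_on_minus)
  qed (use \<open>open \<Omega>\<close> sym assms(8,9,15) bounds thick \<open>q \<in> \<Omega>\<close> in auto)
  ultimately show "u q = 0" by simp
qed

end
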